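(* Let $G$ be a group and $\sigma$ a collection of finite-index subgroups of $G$. Then the following are equivalent: (1) $\sigma$ is semi-conjugacy-separating. (2) For any finite subset $F\subset G$, there is $G_\alpha\in\sigma$ such that $\big(\bigcup_{k\in G}kG_\alpha k^{-1}\big)\cap F\subset\{1\}$. (3) For any finite subset $F\subset G$, there is $G_\alpha\in\sigma$ such that the quotient map $G\to G/G_\alpha$ (onto left cosets) is injective on $F\cdot k$ for every $k\in G$.
   Context: A family $\sigma$ of finite-index (not necessarily normal) subgroups of $G$ is semi-conjugacy-separating if for every non-empty finite subset $F\subset G$ there is $G_\alpha\in\sigma$ such that $G_\alpha\cap g^G G_\alpha=\varnothing$ for every $g\in F\setminus\{1\}$, where $g^G$ is the conjugacy class of $g$ and $g^G G_\alpha=\{xy: x\in g^G,\ y\in G_\alpha\}$. *)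

theory Defs
  imports "HOL-Algebra.Coset" "HOL-Algebra.Left_Coset"
begin

definition finite_index_subgroup :: "'a set \<Rightarrow> ('a, 'b) monoid_scheme \<Rightarrow> bool" where
  "finite_index_subgroup H G \<longleftrightarrow> subgroup H G \<and> finite (lcosets\<^bsub>G\<^esub> H)"

definition conjugacy_class :: "('a, 'b) monoid_scheme \<Rightarrow> 'a \<Rightarrow> 'a set" where
  "conjugacy_class G g = (\<lambda>k. k \<otimes>\<^bsub>G\<^esub> g \<otimes>\<^bsub>G\<^esub> inv\<^bsub>G\<^esub> k) ` carrier G"

text \<open>That the members of \<open>\<sigma>\<close> are finite-index subgroups is a standing assumption on
  \<open>\<sigma>\<close> and is not part of this predicate.\<close>

definition semi_conjugacy_separating :: "('a, 'b) monoid_scheme \<Rightarrow> 'a set set \<Rightarrow> bool" where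
  "semi_conjugacy_separating G \<sigma> \<longleftrightarrow>
     (\<forall>F. F \<subseteq> carrier G \<and> finite F \<and> F \<noteq> {} \<longrightarrow>
       (\<exists>H\<in>\<sigma>. \<forall>g\<in>F - {\<one>\<^bsub>G\<^esub>}. H \<inter> (conjugacy_class G g <#>\<^bsub>G\<^esub> H) = {}))"

end

theory Submission
  imports Defs
begin

text \<open>For a subgroup \<open>H\<close>, let C(H) be the union of its conjugates. For fixed
  \<open>H\<close> and \<open>F\<close>, each of the three conditions says that C(H) meets some
  finite set at most in the identity. In (2) that set is \<open>F\<close> by definition. In (1) it
  is again \<open>F\<close>: since \<open>H\<close> absorbs right multiplication by its own
  elements, \<open>H\<close> meets the product of the class of g with \<open>H\<close> exactly when
  a conjugate of g lies in \<open>H\<close> (\<open>conjugacy_class_mult_disjoint_iff\<close>). In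
  (3) it is the set of quotients F^-1 F: the cosets of xk and yk agree exactly when k^-1 (x^-1 y) k
  lies in \<open>H\<close> (\<open>inj_on_l_coset_translates_iff\<close>).

  What remains concerns only the quantifier over finite sets: F^-1 F is finite when F is, and F is
  contained in the quotient set of F with the identity added.\<close>

context group
begin

lemma l_coset_eq_iff:
  assumes "subgroup H G" "x \<in> carrier G" "y \<in> carrier G"
  shows "x <# H = y <# H \<longleftrightarrow> inv x \<otimes> y \<in> H"
proof
  assume "x <# H = y <# H"
  moreover have "y \<in> y <# H"
    using assms subgroup.one_closed[OF assms(1)] by (force simp: l_coset_def)
  ultimately obtain h where h: "h \<in> H" "y = x \<otimes> h"
    by (auto simp: l_coset_def)
  then have "inv x \<otimes> y = h"
    using assms subgroup.mem_carrier[OF assms(1)] by (simp add: inv_solve_left')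
  with h show "inv x \<otimes> y \<in> H" by simp
next
  assume h: "inv x \<otimes> y \<in> H"
  have "y = x \<otimes> (inv x \<otimes> y)"
    using assms by (simp add: m_assoc[symmetric])
  with h have "y \<in> x <# H"
    unfolding l_coset_def by blast
  then show "x <# H = y <# H"
    using l_repr_independence assms by blast
qed

text \<open>Solves g = k h k^-1 for h. Conditions (1) and (3) both produce conjugates of an element
  that land in \<open>H\<close>; this converts them to membership in C(H).\<close>

lemma mem_Union_conjugates_iff:
  assumes "subgroup H G" "g \<in> carrier G"
  shows "g \<in> (\<Union>k\<in>carrier G. k <# H #> inv k) \<longleftrightarrow> (\<exists>k\<in>carrier G. inv k \<otimes> g \<otimes> k \<in> H)"
proof -
  have "g = k \<otimes> h \<otimes> inv k \<longleftrightarrow> h = inv k \<otimes> g \<otimes> k"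
    if "k \<in> carrier G" "h \<in> H" for k h
  proof -
    have "h \<in> carrier G"
      using that subgroup.mem_carrier[OF assms(1)] by blast
    then have "inv k \<otimes> (k \<otimes> h \<otimes> inv k) \<otimes> k = h" "k \<otimes> (inv k \<otimes> g \<otimes> k) \<otimes> inv k = g"
      using that(1) assms(2) by (simp_all add: m_assoc inv_solve_left' flip: m_assoc[of k "inv k"])
    then show ?thesis by metis
  qed
  then have "g \<in> k <# H #> inv k \<longleftrightarrow> inv k \<otimes> g \<otimes> k \<in> H" if "k \<in> carrier G" for k
    using that by (auto simp: l_coset_def r_coset_def)
  then show ?thesis by auto
qed

text \<open>A factor from \<open>H\<close> on the right does not affect membership in
  \<open>H\<close>, so an intersection point is the same thing as a conjugate of g in
  \<open>H\<close>.\<close>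

lemma conjugacy_class_mult_disjoint_iff:
  assumes "subgroup H G" "g \<in> carrier G"
  shows "H \<inter> (conjugacy_class G g <#> H) = {}
    \<longleftrightarrow> g \<notin> (\<Union>k\<in>carrier G. k <# H #> inv k)"
proof -
  have "k \<otimes> g \<otimes> inv k \<otimes> h \<in> H \<longleftrightarrow> k \<otimes> g \<otimes> inv k \<in> H"
    if "k \<in> carrier G" "h \<in> H" for k h
  proof
    assume a: "k \<otimes> g \<otimes> inv k \<otimes> h \<in> H"
    have "k \<otimes> g \<otimes> inv k = k \<otimes> g \<otimes> inv k \<otimes> h \<otimes> inv h"
      using that assms subgroup.mem_carrier[OF assms(1)] by (simp add: m_assoc)
    then show "k \<otimes> g \<otimes> inv k \<in> H"
      using a that assms(1) by (metis subgroup.m_closed subgroup.m_inv_closed)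
  qed (use that assms(1) in \<open>simp add: subgroup.m_closed\<close>)
  \<comment> \<open>The identity of \<open>H\<close> serves as right factor when a conjugate of g in
    \<open>H\<close> has to be exhibited as a point of the product set.\<close>
  then have "H \<inter> (conjugacy_class G g <#> H) = {} \<longleftrightarrow> (\<forall>k\<in>carrier G. k \<otimes> g \<otimes> inv k \<notin> H)"
    using subgroup.one_closed[OF assms(1)]
    unfolding conjugacy_class_def set_mult_def disjoint_iff by blast
  \<comment> \<open>Inversion permutes the group, so k may be replaced by its inverse.\<close>
  also have "\<dots> \<longleftrightarrow> (\<forall>k\<in>carrier G. inv k \<otimes> g \<otimes> k \<notin> H)"
    by (metis inv_closed inv_inv)
  finally show ?thesis
    using mem_Union_conjugates_iff[OF assms] by simp
qed

text \<open>A failure of injectivity on some translate Fk is a pair of distinct x, y in F for which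
  a conjugate of x^-1 y lies in \<open>H\<close>; letting k vary gives all conjugates, hence
  C(H).\<close>

lemma inj_on_l_coset_translates_iff:
  assumes "subgroup H G" "F \<subseteq> carrier G"
  shows "(\<forall>k\<in>carrier G. inj_on (\<lambda>x. x <# H) (F #> k))
    \<longleftrightarrow> (\<Union>k\<in>carrier G. k <# H #> inv k) \<inter> (\<lambda>(x, y). inv x \<otimes> y) ` (F \<times> F) \<subseteq> {\<one>}"
proof -
  define C where "C = (\<Union>k\<in>carrier G. k <# H #> inv k)"
  have eq: "x \<otimes> k <# H = y \<otimes> k <# H \<longleftrightarrow> inv k \<otimes> (inv x \<otimes> y) \<otimes> k \<in> H"
    if "k \<in> carrier G" "x \<in> F" "y \<in> F" for k x y
    using that assms by (simp add: l_coset_eq_iff inv_mult_group m_assoc subset_iff)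
  have one: "inv x \<otimes> y = \<one> \<longleftrightarrow> x = y" if "x \<in> F" "y \<in> F" for x y
    using that assms(2) by (auto simp: inv_solve_left' subset_iff)
  have "(\<forall>k\<in>carrier G. inj_on (\<lambda>x. x <# H) (F #> k))
    \<longleftrightarrow> (\<forall>k\<in>carrier G. \<forall>x\<in>F. \<forall>y\<in>F. x \<otimes> k <# H = y \<otimes> k <# H \<longrightarrow> x \<otimes> k = y \<otimes> k)"
    by (simp add: inj_on_def r_coset_def)
  \<comment> \<open>\<open>eq\<close> rewrites the premise, and right cancellation of k simplifies
    the conclusion.\<close>
  also have "\<dots> \<longleftrightarrow> (\<forall>k\<in>carrier G. \<forall>x\<in>F. \<forall>y\<in>F.
      inv k \<otimes> (inv x \<otimes> y) \<otimes> k \<in> H \<longrightarrow> x = y)"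
    using assms(2) by (auto simp: eq subset_iff cong: ball_cong)
  \<comment> \<open>The conclusion is now free of k, so the universal k becomes an existential one
    in the premise, which is membership in C(H).\<close>
  also have "\<dots> \<longleftrightarrow> (\<forall>x\<in>F. \<forall>y\<in>F. inv x \<otimes> y \<in> C \<longrightarrow> inv x \<otimes> y = \<one>)"
  proof -
    have "inv x \<otimes> y \<in> C \<longleftrightarrow> (\<exists>k\<in>carrier G. inv k \<otimes> (inv x \<otimes> y) \<otimes> k \<in> H)"
      if "x \<in> F" "y \<in> F" for x y
      unfolding C_def using that assms by (intro mem_Union_conjugates_iff) auto
    then show ?thesis using one by blast
  qed
  also have "\<dots> \<longleftrightarrow> C \<inter> (\<lambda>(x, y). inv x \<otimes> y) ` (F \<times> F) \<subseteq> {\<one>}"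
    by fastforce
  finally show ?thesis unfolding C_def .
qed

end

theorem lemma3p12:
  fixes G :: "('a, 'b) monoid_scheme" and \<sigma> :: "'a set set"
  assumes "group G"
    and "\<And>H. H \<in> \<sigma> \<Longrightarrow> finite_index_subgroup H G"
  shows "(semi_conjugacy_separating G \<sigma> \<longleftrightarrow>
           (\<forall>F. F \<subseteq> carrier G \<and> finite F \<longrightarrow>
             (\<exists>H\<in>\<sigma>. (\<Union>k\<in>carrier G. k <#\<^bsub>G\<^esub> H #>\<^bsub>G\<^esub> inv\<^bsub>G\<^esub> k) \<inter> F \<subseteq> {\<one>\<^bsub>G\<^esub>})))
       \<and> ((\<forall>F. F \<subseteq> carrier G \<and> finite F \<longrightarrow>
             (\<exists>H\<in>\<sigma>. (\<Union>k\<in>carrier G. k <#\<^bsub>G\<^esub> H #>\<^bsub>G\<^esub> inv\<^bsub>G\<^esub> k) \<inter> F \<subseteq> {\<one>\<^bsub>G\<^esub>})) \<longleftrightarrow>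
           (\<forall>F. F \<subseteq> carrier G \<and> finite F \<longrightarrow>
             (\<exists>H\<in>\<sigma>. \<forall>k\<in>carrier G. inj_on (\<lambda>x. x <#\<^bsub>G\<^esub> H) (F #>\<^bsub>G\<^esub> k))))"
proof -
  interpret group G by fact
  have sub: "subgroup H G" if "H \<in> \<sigma>" for H
    using assms(2)[OF that] by (simp add: finite_index_subgroup_def)
  define C where "C H = (\<Union>k\<in>carrier G. k <#\<^bsub>G\<^esub> H #>\<^bsub>G\<^esub> inv\<^bsub>G\<^esub> k)" for H
  define D where "D F = (\<lambda>(x, y). inv\<^bsub>G\<^esub> x \<otimes>\<^bsub>G\<^esub> y) ` (F \<times> F)" for F
  have sep: "(\<forall>g\<in>F - {\<one>\<^bsub>G\<^esub>}. H \<inter> (conjugacy_class G g <#>\<^bsub>G\<^esub> H) = {})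
      \<longleftrightarrow> C H \<inter> F \<subseteq> {\<one>\<^bsub>G\<^esub>}" if "H \<in> \<sigma>" "F \<subseteq> carrier G" for H F
  proof -
    have "H \<inter> (conjugacy_class G g <#>\<^bsub>G\<^esub> H) = {} \<longleftrightarrow> g \<notin> C H" if "g \<in> F" for g
      unfolding C_def using \<open>H \<in> \<sigma>\<close> \<open>F \<subseteq> carrier G\<close> that
      by (intro conjugacy_class_mult_disjoint_iff sub) auto
    then show ?thesis by blast
  qed
  have inj: "(\<forall>k\<in>carrier G. inj_on (\<lambda>x. x <#\<^bsub>G\<^esub> H) (F #>\<^bsub>G\<^esub> k)) \<longleftrightarrow> C H \<inter> D F \<subseteq> {\<one>\<^bsub>G\<^esub>}"
    if "H \<in> \<sigma>" "F \<subseteq> carrier G" for H F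
    unfolding C_def D_def using that by (intro inj_on_l_coset_translates_iff sub)
  let ?P = "\<lambda>F. \<exists>H\<in>\<sigma>. C H \<inter> F \<subseteq> {\<one>\<^bsub>G\<^esub>}"
  have "semi_conjugacy_separating G \<sigma>
      \<longleftrightarrow> (\<forall>F. F \<subseteq> carrier G \<and> finite F \<and> F \<noteq> {} \<longrightarrow> ?P F)"
    unfolding semi_conjugacy_separating_def by (simp add: sep cong: bex_cong imp_cong)
  also have "\<dots> \<longleftrightarrow> (\<forall>F. F \<subseteq> carrier G \<and> finite F \<longrightarrow> ?P F)"
  proof (intro iffI allI impI)
    fix F assume *: "\<forall>F. F \<subseteq> carrier G \<and> finite F \<and> F \<noteq> {} \<longrightarrow> ?P F"
      and "F \<subseteq> carrier G \<and> finite F"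
    \<comment> \<open>Adding the identity makes the set nonempty, so that the empty \<open>F\<close>
      is covered too; a member of \<open>\<sigma>\<close> that works for the larger set works for
      \<open>F\<close>.\<close>
    then have "?P (insert \<one>\<^bsub>G\<^esub> F)" by (intro *[rule_format]) auto
    then show "?P F" by blast
  qed blast
  finally have 12: "semi_conjugacy_separating G \<sigma>
    \<longleftrightarrow> (\<forall>F. F \<subseteq> carrier G \<and> finite F \<longrightarrow> ?P F)" .
  have "(\<forall>F. F \<subseteq> carrier G \<and> finite F \<longrightarrow> ?P F)
    \<longleftrightarrow> (\<forall>F. F \<subseteq> carrier G \<and> finite F \<longrightarrow> ?P (D F))"
  proof (intro iffI allI impI)
    fix F assume *: "\<forall>F. F \<subseteq> carrier G \<and> finite F \<longrightarrow> ?P F" and F: "F \<subseteq> carrier G \<and> finite F"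
    have "D F \<subseteq> carrier G" "finite (D F)"
      using F by (auto simp: D_def)
    with * show "?P (D F)" by blast
  next
    fix F assume *: "\<forall>F. F \<subseteq> carrier G \<and> finite F \<longrightarrow> ?P (D F)" and F: "F \<subseteq> carrier G \<and> finite F"
    \<comment> \<open>With the identity added, every g in \<open>F\<close> is itself a quotient,
      namely 1^-1 g.\<close>
    then have "?P (D (insert \<one>\<^bsub>G\<^esub> F))" by (intro *[rule_format]) auto
    moreover have "F \<subseteq> D (insert \<one>\<^bsub>G\<^esub> F)"
    proof
      fix g assume "g \<in> F"
      then show "g \<in> D (insert \<one>\<^bsub>G\<^esub> F)"
        unfolding D_def using F by (intro image_eqI[of _ _ "(\<one>\<^bsub>G\<^esub>, g)"]) auto
    qed
    ultimately show "?P F" by blast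
  qed
  also have "\<dots> \<longleftrightarrow> (\<forall>F. F \<subseteq> carrier G \<and> finite F \<longrightarrow>
      (\<exists>H\<in>\<sigma>. \<forall>k\<in>carrier G. inj_on (\<lambda>x. x <#\<^bsub>G\<^esub> H) (F #>\<^bsub>G\<^esub> k)))"
    by (simp add: inj cong: bex_cong imp_cong)
  finally show ?thesis
    using 12 unfolding C_def by blast
qed

end
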